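(* Let $B$ be a complete atomic Boolean algebra. Then, in addition to the principles $\Box(\varphi\to\psi)\to(\Box\varphi\to\Box\psi)$, $\neg\Diamond\varphi\leftrightarrow\Box\neg\varphi$, $\varphi\to\Box\Diamond\varphi$, $\Diamond\Box\varphi\to\Box\Diamond\varphi$, $\Diamond\Box\varphi\to\varphi$ and $\Box(\Box(\varphi\to\Box\varphi)\to\varphi)\to(\Diamond\Box\varphi\to\varphi)$ (which belong to $T_H(M_B)$ for every complete Boolean algebra $B$), for every modal formula $\varphi$ the following formulas belong to $T_H(M_B)$: (4) $\Box\varphi\to\Box\Box\varphi$; (5) $\Diamond\varphi\to\Box\Diamond\varphi$; (W5) $\Diamond\Box\varphi\to(\varphi\to\Box\varphi)$.
   Context: Boolean-valued models. For a complete Boolean algebra $B$ (bottom $0$, top $1$, complement $a^\ast$, $a\to b:=a^\ast\vee b$), define by transfinite recursion $V^{(B)}_\alpha=\{x: x$ is a function, $\mathrm{ran}(x)\subseteq B$, and $\mathrm{dom}(x)\subseteq V^{(B)}_\xi$ for some $\xi<\alpha\}$ and $V^{(B)}=\bigcup_\alpha V^{(B)}_\alpha$. Let $L_\in$ be the first-order language of set theory and $L_B$ its expansion by a constant symbol for each element of $V^{(B)}$. The Boolean value $\llbracket\cdot\rrbracket_B$ of $L_B$-sentences is defined recursively by $\llbracket u\in v\rrbracket_B=\bigvee_{x\in\mathrm{dom}(v)}(v(x)\wedge\llbracket x=u\rrbracket_B)$, $\llbracket u=v\rrbracket_B=\bigwedge_{x\in\mathrm{dom}(u)}(u(x)\to\llbracket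 x\in v\rrbracket_B)\wedge\bigwedge_{y\in\mathrm{dom}(v)}(v(y)\to\llbracket y\in u\rrbracket_B)$, the Boolean operations for the connectives, and meets (resp. joins) over $V^{(B)}$ for $\forall$ (resp. $\exists$). $B$ is atomic if every element is the join of a set of atoms (minimal nonzero elements). Internal modal semantics. $\mathsf{Sent}_{\in}$ is the (countable) set of parameter-free $L_\in$-sentences; its elements are used as the atomic propositions of the propositional modal language with $\neg,\wedge,\vee,\to,\Box,\Diamond$. On $B$ let $aRb\iff a\wedge b\neq 0$. Satisfaction in $M_B=\langle B,R,\llbracket\cdot\rrbracket_B\rangle$ at states $b\in B$ (including $b=0$): $M_B,b\models p$ iff $b\le\llbracket p\rrbracket_B$ for $p\in\mathsf{Sent}_{\in}$; modal-language Boolean connectives are interpreted classically at each state; $M_B,b\models\Box\varphi$ iff $M_B,a\models\varphi$ for all $a\in B$ with $bRa$; $M_B,b\models\Diamond\varphi$ iff $M_B,a\models\varphi$ for some $a\in B$ with $bRa$. $T_H(M_B)$ is the set of modal formulas $\varphi$ with $M_B,b\models\varphi$ for all $b\in B$. *)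

theory Defs
  imports "HOL-Algebra.Complete_Lattice" "HOL-Library.Multiset"
begin

section \<open>The universe of sets\<close>

text \<open>
  A type of this class plays the role of the universe \<open>V\<close> of ZFC; HOL sets over it are the classes,
  and \<open>range elts\<close> consists of the classes that are sets. Since Separation and Replacement
  quantify over arbitrary HOL predicates and functions, the axioms are second-order ZFC. Choice for
  sets follows from the choice operator of HOL together with Replacement. HOL itself does not
  prove that such a type exists (it would amount to a consistency proof for ZFC), so the class has no instance here.
\<close>

class zfc =
  fixes elts :: "'a \<Rightarrow> 'a set"
  assumes extensionality: "elts x = elts y \<Longrightarrow> x = y"
    and foundation: "wf {(x, y). x \<in> elts y}"
    and separation: "Y \<subseteq> elts x \<Longrightarrow> Y \<in> range elts"
    and pairing: "{x, y} \<in> range elts"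
    and union: "(\<Union>y\<in>elts x. elts y) \<in> range elts"
    and power_set: "{y. elts y \<subseteq> elts x} \<in> range elts"
    and replacement: "F ` elts x \<in> range elts"
    and infinity: "\<exists>w z. z \<in> elts w \<and> elts z = {} \<and>
      (\<forall>x\<in>elts w. \<exists>y\<in>elts w. elts y = insert x (elts x))"

definition set_of :: "'v::zfc set \<Rightarrow> 'v"
  where "set_of X = (THE x. elts x = X)"

text \<open>Kuratowski pairs.\<close>

definition opair :: "'v::zfc \<Rightarrow> 'v \<Rightarrow> 'v"
  where "opair x y = set_of {set_of {x}, set_of {x, y}}"

definition is_function :: "'v::zfc \<Rightarrow> bool"
  where "is_function f \<longleftrightarrow>
    (\<forall>p\<in>elts f. \<exists>x y. p = opair x y) \<and>
    (\<forall>x y y'. opair x y \<in> elts f \<and> opair x y' \<in> elts f \<longrightarrow> y = y')"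

definition vdom :: "'v::zfc \<Rightarrow> 'v set"
  where "vdom f = {x. \<exists>y. opair x y \<in> elts f}"

definition vran :: "'v::zfc \<Rightarrow> 'v set"
  where "vran f = {y. \<exists>x. opair x y \<in> elts f}"

definition vapp :: "'v::zfc \<Rightarrow> 'v \<Rightarrow> 'v"
  where "vapp f x = (THE y. opair x y \<in> elts f)"

definition transitive_set :: "'v::zfc \<Rightarrow> bool"
  where "transitive_set x \<longleftrightarrow> (\<forall>y\<in>elts x. elts y \<subseteq> elts x)"

definition is_ordinal :: "'v::zfc \<Rightarrow> bool"
  where "is_ordinal \<alpha> \<longleftrightarrow> transitive_set \<alpha> \<and> (\<forall>\<xi>\<in>elts \<alpha>. transitive_set \<xi>)"


section \<open>Complete Boolean algebras\<close>

text \<open>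
  The one-element algebra is admitted. Complements are unique by distributivity.
\<close>

definition complete_boolean :: "'a gorder \<Rightarrow> bool"
  where "complete_boolean B \<longleftrightarrow>
    complete_lattice B \<and>
    (\<forall>a\<in>carrier B. \<forall>b\<in>carrier B. \<forall>c\<in>carrier B.
      a \<sqinter>\<^bsub>B\<^esub> (b \<squnion>\<^bsub>B\<^esub> c) = (a \<sqinter>\<^bsub>B\<^esub> b) \<squnion>\<^bsub>B\<^esub> (a \<sqinter>\<^bsub>B\<^esub> c)) \<and>
    (\<forall>a\<in>carrier B. \<exists>c\<in>carrier B. a \<sqinter>\<^bsub>B\<^esub> c = \<bottom>\<^bsub>B\<^esub> \<and> a \<squnion>\<^bsub>B\<^esub> c = \<top>\<^bsub>B\<^esub>)"

definition compl :: "'a gorder \<Rightarrow> 'a \<Rightarrow> 'a"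
  where "compl B a = (THE c. c \<in> carrier B \<and> a \<sqinter>\<^bsub>B\<^esub> c = \<bottom>\<^bsub>B\<^esub> \<and> a \<squnion>\<^bsub>B\<^esub> c = \<top>\<^bsub>B\<^esub>)"

definition bimp :: "'a gorder \<Rightarrow> 'a \<Rightarrow> 'a \<Rightarrow> 'a"
  where "bimp B a b = compl B a \<squnion>\<^bsub>B\<^esub> b"

definition atoms :: "'a gorder \<Rightarrow> 'a set"
  where "atoms B = {a \<in> carrier B. a \<noteq> \<bottom>\<^bsub>B\<^esub> \<and>
    (\<forall>b\<in>carrier B. b \<noteq> \<bottom>\<^bsub>B\<^esub> \<and> b \<sqsubseteq>\<^bsub>B\<^esub> a \<longrightarrow> b = a)}"

definition atomic :: "'a gorder \<Rightarrow> bool"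
  where "atomic B \<longleftrightarrow> (\<forall>b\<in>carrier B. \<exists>S\<subseteq>atoms B. b = \<Squnion>\<^bsub>B\<^esub> S)"


section \<open>The Boolean-valued universe\<close>

text \<open>
  \<open>VB_level B \<alpha>\<close> is defined by membership recursion on an arbitrary set \<open>\<alpha>\<close>; only its values at ordinals
  are used.
\<close>

function VB_level :: "'v::zfc gorder \<Rightarrow> 'v \<Rightarrow> 'v set"
  where "VB_level B \<alpha> =
    {x. is_function x \<and> vran x \<subseteq> carrier B \<and> (\<exists>\<xi>\<in>elts \<alpha>. vdom x \<subseteq> VB_level B \<xi>)}"
  by auto
termination
  by (relation "inv_image {(x, y). x \<in> elts y} snd") (auto intro: foundation)

declare VB_level.simps [simp del]

definition VB :: "'v::zfc gorder \<Rightarrow> 'v set"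
  where "VB B = (\<Union>\<alpha>\<in>{\<alpha>. is_ordinal \<alpha>}. VB_level B \<alpha>)"

lemma elts_set_of_pair [simp]: "elts (set_of {x, y}) = {x, y}"
proof -
  obtain z where z: "elts z = {x, y}"
    using pairing[of x y] by (metis rangeE)
  have "set_of {x, y} = z"
    unfolding set_of_def using z by (auto intro: extensionality)
  with z show ?thesis by simp
qed

lemma elts_set_of_singleton [simp]: "elts (set_of {x}) = {x}"
  using elts_set_of_pair[of x x] by simp

definition elts_trancl :: "('v::zfc \<times> 'v) set"
  where "elts_trancl = {(x, y). x \<in> elts y}\<^sup>+"

lemma wf_elts_trancl: "wf elts_trancl"
  unfolding elts_trancl_def by (intro wf_trancl foundation)

lemma vdom_elts_trancl:
  assumes "x \<in> vdom f"
  shows "(x, f) \<in> elts_trancl"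
proof -
  let ?r = "{(x, y). x \<in> elts y}"
  obtain y where "opair x y \<in> elts f"
    using assms by (auto simp: vdom_def)
  then have 1: "(opair x y, f) \<in> ?r" by simp
  have 2: "(set_of {x}, opair x y) \<in> ?r" by (simp add: opair_def)
  have 3: "(x, set_of {x}) \<in> ?r" by simp
  show ?thesis
    unfolding elts_trancl_def
    using trancl_into_trancl[OF trancl_into_trancl[OF r_into_trancl[OF 3] 2] 1] .
qed

lemma mult_replace:
  assumes "(x, v) \<in> r"
  shows "({#x, u#}, {#u, v#}) \<in> mult r" "({#x, u#}, {#v, u#}) \<in> mult r"
proof -
  have "({#u#} + {#x#}, {#u#} + {#v#}) \<in> mult r"
    by (rule one_step_implies_mult) (use assms in auto)
  then show "({#x, u#}, {#u, v#}) \<in> mult r" "({#x, u#}, {#v, u#}) \<in> mult r"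
    by (simp_all add: add_mset_commute)
qed

text \<open>\<open>bmem B u v\<close> and \<open>beq B u v\<close> are the Boolean values of \<open>u \<in> v\<close> and \<open>u = v\<close>.\<close>

function bmem :: "'v::zfc gorder \<Rightarrow> 'v \<Rightarrow> 'v \<Rightarrow> 'v"
  and beq :: "'v::zfc gorder \<Rightarrow> 'v \<Rightarrow> 'v \<Rightarrow> 'v"
  where
    "bmem B u v = \<Squnion>\<^bsub>B\<^esub> ((\<lambda>x. vapp v x \<sqinter>\<^bsub>B\<^esub> beq B x u) ` vdom v)"
  | "beq B u v =
      \<Sqinter>\<^bsub>B\<^esub> ((\<lambda>x. bimp B (vapp u x) (bmem B x v)) ` vdom u) \<sqinter>\<^bsub>B\<^esub>
      \<Sqinter>\<^bsub>B\<^esub> ((\<lambda>y. bimp B (vapp v y) (bmem B y u)) ` vdom v)"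
  by pat_completeness auto
termination
  by (relation "inv_image (mult elts_trancl)
        (case_sum (\<lambda>(B, u, v). {#u, v#}) (\<lambda>(B, u, v). {#u, v#}))")
     (auto intro!: wf_inv_image wf_mult wf_elts_trancl mult_replace vdom_elts_trancl)

declare bmem.simps [simp del] beq.simps [simp del]


section \<open>The language of set theory and its Boolean-valued semantics\<close>

datatype fm =
    Mem nat nat
  | Eq nat nat
  | Neg fm
  | Conj fm fm
  | Disj fm fm
  | Imp fm fm
  | All nat fm
  | Ex nat fm

primrec free_vars :: "fm \<Rightarrow> nat set"
  where
    "free_vars (Mem i j) = {i, j}"
  | "free_vars (Eq i j) = {i, j}"
  | "free_vars (Neg p) = free_vars p"
  | "free_vars (Conj p q) = free_vars p \<union> free_vars q"
  | "free_vars (Disj p q) = free_vars p \<union> free_vars q"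
  | "free_vars (Imp p q) = free_vars p \<union> free_vars q"
  | "free_vars (All i p) = free_vars p - {i}"
  | "free_vars (Ex i p) = free_vars p - {i}"

typedef sentence = "{p. free_vars p = {}}"
proof
  show "All 0 (Eq 0 0) \<in> {p. free_vars p = {}}" by simp
qed

text \<open>
  A sentence with constants for elements of \<open>VB B\<close> is represented by a formula together with an
  assignment \<open>e\<close> of elements of \<open>VB B\<close> to its free variables.
\<close>

primrec bval :: "'v::zfc gorder \<Rightarrow> fm \<Rightarrow> (nat \<Rightarrow> 'v) \<Rightarrow> 'v"
  where
    "bval B (Mem i j) e = bmem B (e i) (e j)"
  | "bval B (Eq i j) e = beq B (e i) (e j)"
  | "bval B (Neg p) e = compl B (bval B p e)"
  | "bval B (Conj p q) e = bval B p e \<sqinter>\<^bsub>B\<^esub> bval B q e"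
  | "bval B (Disj p q) e = bval B p e \<squnion>\<^bsub>B\<^esub> bval B q e"
  | "bval B (Imp p q) e = bimp B (bval B p e) (bval B q e)"
  | "bval B (All i p) e = \<Sqinter>\<^bsub>B\<^esub> ((\<lambda>u. bval B p (e(i := u))) ` VB B)"
  | "bval B (Ex i p) e = \<Squnion>\<^bsub>B\<^esub> ((\<lambda>u. bval B p (e(i := u))) ` VB B)"

text \<open>The value of a sentence does not depend on the assignment; the empty name is used.\<close>

definition sval :: "'v::zfc gorder \<Rightarrow> sentence \<Rightarrow> 'v"
  where "sval B p = bval B (Rep_sentence p) (\<lambda>_. set_of {})"


section \<open>Internal modal semantics\<close>

datatype modal =
    Atom sentence
  | MNot modal  ("\<^bold>\<not> _" [60] 60)
  | MAnd modal modal  (infixr "\<^bold>\<and>" 55)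
  | MOr modal modal  (infixr "\<^bold>\<or>" 50)
  | MImp modal modal  (infixr "\<^bold>\<rightarrow>" 45)
  | Box modal  ("\<^bold>\<box> _" [60] 60)
  | Dia modal  ("\<^bold>\<diamond> _" [60] 60)

abbreviation MIff :: "modal \<Rightarrow> modal \<Rightarrow> modal"  (infix "\<^bold>\<leftrightarrow>" 40)
  where "\<phi> \<^bold>\<leftrightarrow> \<psi> \<equiv> (\<phi> \<^bold>\<rightarrow> \<psi>) \<^bold>\<and> (\<psi> \<^bold>\<rightarrow> \<phi>)"

definition compat :: "'a gorder \<Rightarrow> 'a \<Rightarrow> 'a \<Rightarrow> bool"
  where "compat B a b \<longleftrightarrow> a \<sqinter>\<^bsub>B\<^esub> b \<noteq> \<bottom>\<^bsub>B\<^esub>"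

primrec sat :: "'v::zfc gorder \<Rightarrow> 'v \<Rightarrow> modal \<Rightarrow> bool"
  where
    "sat B b (Atom p) \<longleftrightarrow> b \<sqsubseteq>\<^bsub>B\<^esub> sval B p"
  | "sat B b (\<^bold>\<not> \<phi>) \<longleftrightarrow> \<not> sat B b \<phi>"
  | "sat B b (\<phi> \<^bold>\<and> \<psi>) \<longleftrightarrow> sat B b \<phi> \<and> sat B b \<psi>"
  | "sat B b (\<phi> \<^bold>\<or> \<psi>) \<longleftrightarrow> sat B b \<phi> \<or> sat B b \<psi>"
  | "sat B b (\<phi> \<^bold>\<rightarrow> \<psi>) \<longleftrightarrow> (sat B b \<phi> \<longrightarrow> sat B b \<psi>)"
  | "sat B b (\<^bold>\<box> \<phi>) \<longleftrightarrow> (\<forall>a\<in>carrier B. compat B b a \<longrightarrow> sat B a \<phi>)"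
  | "sat B b (\<^bold>\<diamond> \<phi>) \<longleftrightarrow> (\<exists>a\<in>carrier B. compat B b a \<and> sat B a \<phi>)"

definition TH :: "'v::zfc gorder \<Rightarrow> modal set"
  where "TH B = {\<phi>. \<forall>b\<in>carrier B. sat B b \<phi>}"

end

(*
  A permutation of the atoms of B extends to an automorphism f of B, and f extends recursively to a
  permutation of V^(B) that carries Boolean values to their images under f. Hence the value of every
  parameter-free sentence is fixed by all these automorphisms, so if B is atomic it lies above
  all atoms or above none, i.e. it is 0 or 1. It follows that all nonzero states satisfy the same
  modal formulas, while the state 0 sees nothing; (4), (5) and (W5) are then immediate. The
  remaining principles only use that compatibility is symmetric.
*)

theory Submission
  imports Defs "HOL-Combinatorics.Transposition"
begin

section \<open>Sets and functions in the universe\<close>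

lemma elts_set_of: "X \<in> range elts \<Longrightarrow> elts (set_of X) = (X :: 'v::zfc set)"
  unfolding set_of_def by (metis (mono_tags, lifting) extensionality rangeE theI)

lemma set_of_elts: "set_of (elts x) = (x :: 'v::zfc)"
  by (simp add: elts_set_of extensionality)

lemma image_in_range_elts: "X \<in> range elts \<Longrightarrow> F ` X \<in> range elts"
  for X :: "'v::zfc set" and F :: "'v \<Rightarrow> 'v"
  using replacement by blast

lemma subset_in_range_elts: "X \<in> range elts \<Longrightarrow> Y \<subseteq> X \<Longrightarrow> Y \<in> range (elts :: 'v::zfc \<Rightarrow> 'v set)"
  using separation by auto

lemma elts_set_of_empty: "elts (set_of {} :: 'v::zfc) = {}"
proof (rule elts_set_of)
  show "{} \<in> range (elts :: 'v \<Rightarrow> 'v set)"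
    using subset_in_range_elts[OF rangeI] by blast
qed

lemma opair_inject: "opair x y = opair x' y' \<longleftrightarrow> x = x' \<and> y = (y' :: 'v::zfc)"
proof
  have elts_opair: "elts (opair a b) = {set_of {a}, set_of {a, b}}" for a b :: 'v
    by (simp add: opair_def)
  have set_of_pair_iff: "set_of {a, b} = set_of {c, d} \<longleftrightarrow> {a, b} = {c, d}" for a b c d :: 'v
    by (metis elts_set_of_pair)
  assume "opair x y = opair x' y'"
  then have "{set_of {x, x}, set_of {x, y}} = {set_of {x', x'}, set_of {x', y'}}"
    by (metis elts_opair insert_absorb2)
  then show "x = x' \<and> y = y'"
    by (simp only: doubleton_eq_iff set_of_pair_iff) blast
qed simp

text \<open>Replacement turns the first-coordinate map into a set. Elements of \<open>u\<close> that
  are not pairs may contribute arbitrary values, so the domain is only contained in that image and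
  separation cuts it out.\<close>

lemma vdom_in_range_elts: "vdom u \<in> range (elts :: 'v::zfc \<Rightarrow> 'v set)"
proof (rule subset_in_range_elts)
  show "(\<lambda>p. THE x. \<exists>y. p = opair x y) ` elts u \<in> range elts"
    by (rule replacement)
  show "vdom u \<subseteq> (\<lambda>p. THE x. \<exists>y. p = opair x y) ` elts u"
  proof
    fix x assume "x \<in> vdom u"
    then obtain y where "opair x y \<in> elts u"
      by (auto simp: vdom_def)
    moreover have "(THE x'. \<exists>y'. opair x y = opair x' y') = x"
      by (auto simp: opair_inject)
    ultimately show "x \<in> (\<lambda>p. THE x. \<exists>y. p = opair x y) ` elts u"
      by (intro image_eqI) (rule sym)
  qed
qed

lemma vapp_eq: "is_function u \<Longrightarrow> opair x y \<in> elts u \<Longrightarrow> vapp u x = y"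
  unfolding vapp_def is_function_def by (rule the_equality) blast+

lemma opair_vapp: "is_function u \<Longrightarrow> x \<in> vdom u \<Longrightarrow> opair x (vapp u x) \<in> elts u"
  by (auto simp: vdom_def) (metis vapp_eq)

lemma elts_function: "is_function u \<Longrightarrow> elts u = (\<lambda>x. opair x (vapp u x)) ` vdom u"
proof (rule equalityI)
  assume u: "is_function u"
  show "elts u \<subseteq> (\<lambda>x. opair x (vapp u x)) ` vdom u"
  proof
    fix p assume p: "p \<in> elts u"
    with u obtain x y where xy: "p = opair x y"
      unfolding is_function_def by blast
    with u p show "p \<in> (\<lambda>x. opair x (vapp u x)) ` vdom u"
      using vapp_eq[OF u, of x y] by (auto simp: vdom_def)
  qed
  show "(\<lambda>x. opair x (vapp u x)) ` vdom u \<subseteq> elts u"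
    using opair_vapp[OF u] by blast
qed


section \<open>Transporting names along a map\<close>

text \<open>The map of names induced by an automorphism \<open>f\<close> of the algebra. It is
  defined for every \<open>f\<close> and every set, so the recursion needs only that members of a
  domain are earlier sets; that the result is again a function is secured afterwards through
  injectivity.\<close>

function push :: "('v::zfc \<Rightarrow> 'v) \<Rightarrow> 'v \<Rightarrow> 'v"
  where "push f u = set_of ((\<lambda>x. opair (push f x) (f (vapp u x))) ` vdom u)"
  by auto
termination
  by (relation "inv_image elts_trancl snd") (auto intro: wf_elts_trancl vdom_elts_trancl)

declare push.simps [simp del]

lemma elts_push: "elts (push f u) = (\<lambda>x. opair (push f x) (f (vapp u x))) ` vdom u"
  by (subst push.simps) (rule elts_set_of, rule image_in_range_elts, rule vdom_in_range_elts)

lemma vdom_push: "vdom (push f u) = push f ` vdom u"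
  by (auto simp: vdom_def[of "push f u"] elts_push opair_inject)

text \<open>Injectivity prevents two elements of the domain with different values from being merged
  into one.\<close>

lemma is_function_push:
  assumes "inj_on (push f) (vdom u)"
  shows "is_function (push f u)"
  using assms by (auto simp: is_function_def elts_push opair_inject dest: inj_onD)

lemma vapp_push:
  assumes "inj_on (push f) (vdom u)" "x \<in> vdom u"
  shows "vapp (push f u) (push f x) = f (vapp u x)"
  by (rule vapp_eq[OF is_function_push[OF assms(1)]]) (use assms(2) in \<open>auto simp: elts_push\<close>)

text \<open>This makes the default assignment used by \<open>sval\<close> invariant.\<close>

lemma push_empty: "push f (set_of {}) = set_of {}"
proof -
  have "vdom (set_of {} :: 'a) = {}"
    by (simp add: vdom_def elts_set_of_empty)
  then show ?thesis
    by (subst push.simps) simp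
qed

section \<open>The hierarchy of names and its stability under transport\<close>

lemma ordinal_elem: "is_ordinal \<alpha> \<Longrightarrow> \<xi> \<in> elts \<alpha> \<Longrightarrow> is_ordinal \<xi>"
  unfolding is_ordinal_def transitive_set_def by blast

lemma VB_levelD:
  assumes "u \<in> VB_level B \<alpha>"
  shows "is_function u" "vran u \<subseteq> carrier B"
    and "\<exists>\<xi>\<in>elts \<alpha>. vdom u \<subseteq> VB_level B \<xi>"
  using assms by (subst (asm) VB_level.simps, simp)+

lemma VB_level_subset_VB: "is_ordinal \<alpha> \<Longrightarrow> VB_level B \<alpha> \<subseteq> VB B"
  by (auto simp: VB_def)

lemma VBE:
  assumes "u \<in> VB B"
  obtains \<alpha> where "is_ordinal \<alpha>" "u \<in> VB_level B \<alpha>"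
  using assms by (auto simp: VB_def)

lemma VB_is_function: "u \<in> VB B \<Longrightarrow> is_function u"
  by (metis VBE VB_levelD(1))

lemma VB_vdom: "u \<in> VB B \<Longrightarrow> x \<in> vdom u \<Longrightarrow> x \<in> VB B"
  by (elim VBE) (meson VB_levelD(3) VB_level_subset_VB ordinal_elem subsetD)

lemma VB_vapp:
  assumes "u \<in> VB B" "x \<in> vdom u"
  shows "vapp u x \<in> carrier B"
proof -
  have "vran u \<subseteq> carrier B"
    using assms(1) by (metis VBE VB_levelD(2))
  then show ?thesis
    using opair_vapp[OF VB_is_function] assms unfolding vran_def by blast
qed

text \<open>Well-founded induction along the transitive closure of membership replaces induction on
  rank, because domains of names consist of names.\<close>

lemma VB_induct [consumes 1, case_names step]:
  assumes "u \<in> VB B"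
    and step: "\<And>u. u \<in> VB B \<Longrightarrow> (\<And>x. x \<in> vdom u \<Longrightarrow> P x) \<Longrightarrow> P u"
  shows "P u"
  using assms(1)
  by (induction u rule: wf_induct_rule[OF wf_elts_trancl])
    (blast intro: step VB_vdom vdom_elts_trancl)

lemma empty_in_VB: "set_of {} \<in> VB B"
proof -
  let ?e = "set_of {} :: 'a"
  \<comment> \<open>The ordinal 1 is used: level 0 is empty, since membership in a level requires an
    element of its index.\<close>
  have "is_ordinal (set_of {?e})"
    by (simp add: is_ordinal_def transitive_set_def elts_set_of_empty)
  moreover have "?e \<in> VB_level B (set_of {?e})"
    by (subst VB_level.simps) (simp add: is_function_def vran_def vdom_def elts_set_of_empty)
  ultimately show ?thesis
    by (auto simp: VB_def)
qed

text \<open>Evaluating \<open>push f u\<close> requires injectivity of \<open>push f\<close> on the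
  domain of \<open>u\<close>, and injectivity in turn comes from a left inverse. The induction
  breaks this circle: the hypothesis for the elements of the domain already provides a left inverse
  there.\<close>

lemma push_push:
  assumes "u \<in> VB B" and gf: "\<And>b. b \<in> carrier B \<Longrightarrow> g (f b) = b"
  shows "push g (push f u) = u"
  using assms(1)
proof (induction rule: VB_induct)
  case (step u)
  then have inj: "inj_on (push f) (vdom u)"
    by (metis inj_onI)
  have "push g (push f u) =
    set_of ((\<lambda>x. opair (push g (push f x)) (g (vapp (push f u) (push f x)))) ` vdom u)"
    by (subst push.simps) (simp add: vdom_push image_image)
  also have "(\<lambda>x. opair (push g (push f x)) (g (vapp (push f u) (push f x)))) ` vdom u =
      (\<lambda>x. opair x (vapp u x)) ` vdom u"
    using step by (intro image_cong) (auto simp: vapp_push[OF inj] gf VB_vapp)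
  also have "\<dots> = elts u"
    using elts_function[OF VB_is_function[OF step(1)]] by simp
  finally show ?case
    by (simp add: set_of_elts)
qed

lemma inj_on_push:
  assumes "\<And>b. b \<in> carrier B \<Longrightarrow> g (f b) = b"
  shows "inj_on (push f) (VB B)"
  using push_push[where f = f and g = g, OF _ assms] by (rule inj_on_inverseI)

text \<open>Even the individual levels are preserved: the index \<xi> that bounds the domain of
  \<open>u\<close> also bounds the domain of \<open>push f u\<close>, by induction on the
  ordinal.\<close>

lemma push_in_VB_level:
  assumes gf: "\<And>b. b \<in> carrier B \<Longrightarrow> g (f b) = b"
    and f: "\<And>b. b \<in> carrier B \<Longrightarrow> f b \<in> carrier B"
  shows "is_ordinal \<alpha> \<Longrightarrow> u \<in> VB_level B \<alpha> \<Longrightarrow> push f u \<in> VB_level B \<alpha>"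
proof (induction \<alpha> arbitrary: u rule: wf_induct_rule[OF foundation])
  case (1 \<alpha>)
  then have u: "u \<in> VB B"
    using VB_level_subset_VB by blast
  then have "vdom u \<subseteq> VB B"
    by (auto intro: VB_vdom)
  then have "is_function (push f u)"
    using inj_on_subset[OF inj_on_push[where f = f and g = g, OF gf]] is_function_push by blast
  moreover have "vran (push f u) \<subseteq> carrier B"
    using VB_vapp[OF u] f by (auto simp: vran_def elts_push opair_inject)
  moreover obtain \<xi> where \<xi>: "\<xi> \<in> elts \<alpha>" "vdom u \<subseteq> VB_level B \<xi>"
    using VB_levelD(3)[OF 1(3)] by blast
  moreover have "vdom (push f u) \<subseteq> VB_level B \<xi>"
    using \<xi> 1(1)[of \<xi>] ordinal_elem[OF 1(2) \<xi>(1)] by (auto simp: vdom_push)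
  ultimately show ?case
    by (subst VB_level.simps) blast
qed

lemma push_in_VB:
  assumes "\<And>b. b \<in> carrier B \<Longrightarrow> g (f b) = b"
    and "\<And>b. b \<in> carrier B \<Longrightarrow> f b \<in> carrier B"
    and "u \<in> VB B"
  shows "push f u \<in> VB B"
  using assms(3) by (elim VBE) (use push_in_VB_level[OF assms(1,2)] VB_level_subset_VB in blast)


section \<open>Complete Boolean algebras and their automorphisms\<close>

locale complete_boolean_algebra = complete_lattice B for B :: "'a gorder" (structure) +
  assumes meet_join_distrib:
      "\<lbrakk>a \<in> carrier B; b \<in> carrier B; c \<in> carrier B\<rbrakk> \<Longrightarrow> a \<sqinter> (b \<squnion> c) = (a \<sqinter> b) \<squnion> (a \<sqinter> c)"
    and compl_exists:
      "a \<in> carrier B \<Longrightarrow> \<exists>c\<in>carrier B. a \<sqinter> c = \<bottom> \<and> a \<squnion> c = \<top>"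
begin

lemma join_bottom: "a \<in> carrier B \<Longrightarrow> \<bottom> \<squnion> a = a"
  using bottom_join by (simp add: eq_is_equal)

lemma meet_top: "a \<in> carrier B \<Longrightarrow> a \<sqinter> \<top> = a"
  using top_meet by (simp add: eq_is_equal meet_comm)

lemma meet_bottom: "a \<in> carrier B \<Longrightarrow> a \<sqinter> \<bottom> = \<bottom>"
  using bottom_meet by (simp add: eq_is_equal meet_comm)

lemma meet_idem: "a \<in> carrier B \<Longrightarrow> a \<sqinter> a = a"
  by (meson le_antisym le_refl meet_closed meet_le meet_left)

text \<open>Distribute \<open>d\<close> over \<open>a \<squnion> c = \<top>\<close>. Applied in both
  directions this yields uniqueness of complements; it also places everything disjoint from an atom
  below the complement of that atom.\<close>

lemma disjoint_le:
  assumes "a \<in> carrier B" "c \<in> carrier B" "d \<in> carrier B" "a \<sqinter> d = \<bottom>" "a \<squnion> c = \<top>"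
  shows "d \<sqsubseteq> c"
proof -
  have "d = d \<sqinter> (a \<squnion> c)"
    using assms by (simp add: meet_top)
  also have "\<dots> = (d \<sqinter> a) \<squnion> (d \<sqinter> c)"
    using assms by (intro meet_join_distrib)
  also have "\<dots> = d \<sqinter> c"
    using assms by (simp add: join_bottom meet_comm[of B d a])
  also have "\<dots> \<sqsubseteq> c"
    using assms by (simp add: meet_right)
  finally show ?thesis .
qed

lemma compl_eqI:
  assumes "a \<in> carrier B" "c \<in> carrier B" "a \<sqinter> c = \<bottom>" "a \<squnion> c = \<top>"
  shows "compl B a = c"
  unfolding compl_def
  by (rule the_equality) (use assms disjoint_le[of a] in \<open>auto intro!: le_antisym\<close>)

lemma
  assumes "a \<in> carrier B"
  shows compl_closed [simp]: "compl B a \<in> carrier B"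
    and meet_compl: "a \<sqinter> compl B a = \<bottom>"
    and join_compl: "a \<squnion> compl B a = \<top>"
  using compl_exists[OF assms] compl_eqI[OF assms] by metis+

lemma bimp_closed [simp]: "a \<in> carrier B \<Longrightarrow> b \<in> carrier B \<Longrightarrow> bimp B a b \<in> carrier B"
  by (simp add: bimp_def)

lemma compat_commute: "compat B a b \<longleftrightarrow> compat B b a"
  by (simp add: compat_def meet_comm)

lemma compat_refl: "a \<in> carrier B \<Longrightarrow> a \<noteq> \<bottom> \<Longrightarrow> compat B a a"
  by (simp add: compat_def meet_idem)

lemma compat_nonbottom:
  assumes "compat B a b" "a \<in> carrier B" "b \<in> carrier B"
  shows "a \<noteq> \<bottom>" "b \<noteq> \<bottom>"
  using assms meet_bottom meet_comm[of B \<bottom>] by (auto simp: compat_def)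

section \<open>Atoms, and elements as sets of atoms\<close>

lemma atom_carrier: "p \<in> atoms B \<Longrightarrow> p \<in> carrier B"
  by (simp add: atoms_def)

text \<open>The complement of \<open>p\<close> stands in for infinite distributivity. Distinct atoms
  are disjoint, so if \<open>p\<close> were not in \<open>S\<close>, every member of
  \<open>S\<close>, and hence the join, would lie below \<open>compl B p\<close>; then
  \<open>p\<close> would lie below its own complement and be zero.\<close>

lemma atom_le_sup:
  assumes p: "p \<in> atoms B" and S: "S \<subseteq> atoms B" and le: "p \<sqsubseteq> \<Squnion>S"
  shows "p \<in> S"
proof (rule ccontr)
  assume "p \<notin> S"
  have pc: "p \<in> carrier B" and Sc: "S \<subseteq> carrier B"
    using p S atom_carrier by auto
  have "s \<sqsubseteq> compl B p" if s: "s \<in> S" for s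
  proof -
    have sc: "s \<in> carrier B"
      using s Sc by blast
    have "p \<sqinter> s = \<bottom>"
    proof (rule ccontr)
      assume "p \<sqinter> s \<noteq> \<bottom>"
      then have "p \<sqinter> s = p" "p \<sqinter> s = s"
        using p s S pc sc meet_left meet_right meet_closed by (auto simp: atoms_def)
      with s \<open>p \<notin> S\<close> show False
        by simp
    qed
    then show ?thesis
      using disjoint_le[of p] pc sc join_compl by simp
  qed
  then have "\<Squnion>S \<sqsubseteq> compl B p"
    using Sc pc by (intro sup_least) auto
  then have "p \<sqsubseteq> compl B p"
    using le pc Sc le_trans by (meson compl_closed sup_closed)
  then have "p \<sqsubseteq> p \<sqinter> compl B p"
    using pc by (simp add: meet_le)
  then have "p = \<bottom>"
    using pc by (simp add: meet_compl le_antisym)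
  with p show False
    by (simp add: atoms_def)
qed

text \<open>For atomic \<open>B\<close> this map and \<open>\<Squnion>\<close> are mutually inverse
  order isomorphisms between \<open>B\<close> and the power set of its atoms, as the following
  lemmas show.\<close>

definition atoms_below :: "'a \<Rightarrow> 'a set"
  where "atoms_below b = {p \<in> atoms B. p \<sqsubseteq> b}"

lemma atoms_below_subset: "atoms_below b \<subseteq> atoms B"
  by (auto simp: atoms_below_def)

lemma atoms_below_sup: "S \<subseteq> atoms B \<Longrightarrow> atoms_below (\<Squnion>S) = S"
  using atom_le_sup atom_carrier by (auto simp: atoms_below_def intro!: sup_upper)

lemma sup_atoms_below:
  assumes "atomic B" "b \<in> carrier B"
  shows "\<Squnion>(atoms_below b) = b"
proof -
  obtain S where "S \<subseteq> atoms B" "b = \<Squnion>S"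
    using assms by (auto simp: atomic_def)
  then show ?thesis
    by (simp add: atoms_below_sup)
qed

lemma le_iff_atoms_below:
  assumes "atomic B" "b \<in> carrier B" "c \<in> carrier B"
  shows "b \<sqsubseteq> c \<longleftrightarrow> atoms_below b \<subseteq> atoms_below c"
proof
  assume "b \<sqsubseteq> c"
  then show "atoms_below b \<subseteq> atoms_below c"
    using assms le_trans atom_carrier by (auto simp: atoms_below_def)
next
  assume *: "atoms_below b \<subseteq> atoms_below c"
  have "\<Squnion>(atoms_below b) \<sqsubseteq> c"
    using * assms atom_carrier by (intro sup_least) (auto simp: atoms_below_def)
  then show "b \<sqsubseteq> c"
    using sup_atoms_below assms by simp
qed

end

lemma complete_boolean_algebraI: "complete_boolean B \<Longrightarrow> complete_boolean_algebra B"
  by (simp add: complete_boolean_def complete_boolean_algebra_def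
      complete_boolean_algebra_axioms_def)

section \<open>Order automorphisms of a complete Boolean algebra\<close>

locale boolean_automorphism = complete_boolean_algebra B for B :: "'a gorder" (structure) +
  fixes f :: "'a \<Rightarrow> 'a"
  assumes bij: "bij_betw f (carrier B) (carrier B)"
    and le_iff: "\<lbrakk>a \<in> carrier B; b \<in> carrier B\<rbrakk> \<Longrightarrow> f a \<sqsubseteq> f b \<longleftrightarrow> a \<sqsubseteq> b"
begin

lemma f_closed [simp]: "a \<in> carrier B \<Longrightarrow> f a \<in> carrier B"
  using bij by (auto simp: bij_betw_def)

lemma f_surj: "b \<in> carrier B \<Longrightarrow> \<exists>a\<in>carrier B. b = f a"
  using bij by (auto simp: bij_betw_def)

abbreviation f_inv :: "'a \<Rightarrow> 'a"
  where "f_inv \<equiv> inv_into (carrier B) f"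

lemma f_inv_left: "b \<in> carrier B \<Longrightarrow> f_inv (f b) = b"
  using bij by (simp add: bij_betw_def)

lemma f_inv_right: "b \<in> carrier B \<Longrightarrow> f (f_inv b) = b"
  using bij by (simp add: bij_betw_def f_inv_into_f)

lemma f_inv_closed: "b \<in> carrier B \<Longrightarrow> f_inv b \<in> carrier B"
  using bij by (metis bij_betw_def inv_into_into)

text \<open>Automorphisms are defined by the order alone, so preservation of the operations has to
  be derived. By surjectivity the join of the image is some \<open>f s\<close>; since
  \<open>f\<close> reflects the order, \<open>s\<close> bounds \<open>A\<close>, which gives the
  inequality that monotonicity does not. Meets are dual.\<close>

lemma f_sup:
  assumes A: "A \<subseteq> carrier B"
  shows "f (\<Squnion>A) = \<Squnion>(f ` A)"
proof (rule le_antisym)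
  have fA: "f ` A \<subseteq> carrier B"
    using A by auto
  then obtain s where s: "s \<in> carrier B" "\<Squnion>(f ` A) = f s"
    using f_surj sup_closed by metis
  have "a \<sqsubseteq> s" if "a \<in> A" for a
    using le_iff[of a s] s sup_upper[OF fA, of "f a"] that A by auto
  then have "\<Squnion>A \<sqsubseteq> s"
    using A s by (intro sup_least) auto
  then show "f (\<Squnion>A) \<sqsubseteq> \<Squnion>(f ` A)"
    using s A by (simp add: le_iff)
  show "\<Squnion>(f ` A) \<sqsubseteq> f (\<Squnion>A)"
    using A fA sup_upper[OF A] by (intro sup_least) (auto simp: le_iff subsetD)
qed (use A in \<open>auto intro!: sup_closed f_closed\<close>)

lemma f_inf:
  assumes A: "A \<subseteq> carrier B"
  shows "f (\<Sqinter>A) = \<Sqinter>(f ` A)"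
proof (rule le_antisym)
  have fA: "f ` A \<subseteq> carrier B"
    using A by auto
  then obtain s where s: "s \<in> carrier B" "\<Sqinter>(f ` A) = f s"
    using f_surj inf_closed by metis
  have "s \<sqsubseteq> a" if "a \<in> A" for a
    using le_iff[of s a] s inf_lower[OF fA, of "f a"] that A by auto
  then have "s \<sqsubseteq> \<Sqinter>A"
    using A s by (intro inf_greatest) auto
  then show "\<Sqinter>(f ` A) \<sqsubseteq> f (\<Sqinter>A)"
    using s A by (simp add: le_iff)
  show "f (\<Sqinter>A) \<sqsubseteq> \<Sqinter>(f ` A)"
    using A fA inf_lower[OF A] by (intro inf_greatest) (auto simp: le_iff subsetD)
qed (use A in \<open>auto intro!: inf_closed f_closed\<close>)

lemma f_join: "a \<in> carrier B \<Longrightarrow> b \<in> carrier B \<Longrightarrow> f (a \<squnion> b) = f a \<squnion> f b"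
  by (simp add: join_def f_sup)

lemma f_meet: "a \<in> carrier B \<Longrightarrow> b \<in> carrier B \<Longrightarrow> f (a \<sqinter> b) = f a \<sqinter> f b"
  by (simp add: meet_def f_inf)

lemma f_bottom: "f \<bottom> = \<bottom>"
  by (metis bottom_closed bottom_lower f_closed f_surj le_antisym le_iff)

lemma f_top: "f \<top> = \<top>"
  by (metis top_closed top_higher f_closed f_surj le_antisym le_iff)

lemma f_compl:
  assumes "a \<in> carrier B"
  shows "f (compl B a) = compl B (f a)"
proof -
  have "f a \<sqinter> f (compl B a) = \<bottom>" "f a \<squnion> f (compl B a) = \<top>"
    using assms f_meet[of a "compl B a"] f_join[of a "compl B a"]
    by (simp_all add: meet_compl join_compl f_bottom f_top)
  then show ?thesis
    using assms by (intro compl_eqI[symmetric]) simp_all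
qed

lemma f_bimp: "a \<in> carrier B \<Longrightarrow> b \<in> carrier B \<Longrightarrow> f (bimp B a b) = bimp B (f a) (f b)"
  by (simp add: bimp_def f_join f_compl)

end

section \<open>Automorphisms induced by permutations of the atoms\<close>

context complete_boolean_algebra
begin

text \<open>Under the identification of \<open>B\<close> with the power set of its atoms, the map is
  the direct image under \<sigma>, and a bijection of the atoms induces an order automorphism of
  their power set.\<close>

lemma boolean_automorphism_of_atom_permutation:
  assumes "atomic B" and \<sigma>: "bij_betw \<sigma> (atoms B) (atoms B)"
  shows "boolean_automorphism B (\<lambda>b. \<Squnion>(\<sigma> ` atoms_below b))"
proof unfold_locales
  let ?f = "\<lambda>b. \<Squnion>(\<sigma> ` atoms_below b)"
  have image_below: "\<sigma> ` atoms_below b \<subseteq> atoms B" for b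
    using \<sigma> atoms_below_subset by (fastforce simp: bij_betw_def)
  have closed: "?f b \<in> carrier B" for b
    using image_below atom_carrier by (intro sup_closed) blast
  have below: "atoms_below (?f b) = \<sigma> ` atoms_below b" for b
    by (rule atoms_below_sup[OF image_below])
  show le: "?f a \<sqsubseteq> ?f b \<longleftrightarrow> a \<sqsubseteq> b" if "a \<in> carrier B" "b \<in> carrier B" for a b
  proof -
    have "?f a \<sqsubseteq> ?f b \<longleftrightarrow> \<sigma> ` atoms_below a \<subseteq> \<sigma> ` atoms_below b"
      using le_iff_atoms_below[OF assms(1) closed closed] below by simp
    \<comment> \<open>An inclusion is expressed as the equality of a union with the larger set, so
      that injectivity of \<sigma> can be applied to an equality of images.\<close>
    also have "\<dots> \<longleftrightarrow> atoms_below a \<subseteq> atoms_below b"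
      using inj_on_image_eq_iff[OF bij_betw_imp_inj_on[OF \<sigma>],
          of "atoms_below a \<union> atoms_below b" "atoms_below b"]
      by (simp add: atoms_below_subset image_Un subset_Un_eq[of _ "atoms_below b"]
          subset_Un_eq[of _ "\<sigma> ` atoms_below b"])
    finally show ?thesis
      using le_iff_atoms_below[OF assms(1)] that by simp
  qed
  show "bij_betw ?f (carrier B) (carrier B)"
  proof (rule bij_betw_imageI)
    show "inj_on ?f (carrier B)"
      by (rule inj_onI) (metis closed le le_antisym le_refl)
    have "b \<in> ?f ` carrier B" if b: "b \<in> carrier B" for b
    proof -
      \<comment> \<open>A preimage of \<open>b\<close> is found by pulling its set of atoms back
        along \<sigma> and taking the join.\<close>
      obtain S where S: "S \<subseteq> atoms B" "\<sigma> ` S = atoms_below b"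
        using \<sigma> atoms_below_subset[of b] by (metis bij_betw_def subset_imageE)
      then have "?f (\<Squnion>S) = b"
        using b by (simp add: atoms_below_sup sup_atoms_below assms(1))
      moreover have "\<Squnion>S \<in> carrier B"
        using S atom_carrier by (intro sup_closed) blast
      ultimately show ?thesis
        by blast
    qed
    then show "?f ` carrier B = carrier B"
      using closed by blast
  qed
qed

text \<open>If an atom \<open>p\<close> lies below \<open>s\<close>, then for any atom
  \<open>q\<close> the transposition of \<open>p\<close> and \<open>q\<close> induces an
  automorphism that fixes \<open>s\<close> and carries \<open>p\<close> to \<open>q\<close>, so
  \<open>q\<close> lies below \<open>s\<close> too. Hence \<open>s\<close> is above all atoms or
  above none.\<close>

lemma fixed_by_automorphisms:
  assumes "atomic B" and s: "s \<in> carrier B"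
    and fixed: "\<And>f. boolean_automorphism B f \<Longrightarrow> f s = s"
  shows "s = \<bottom> \<or> s = \<top>"
proof (cases "atoms_below s = {}")
  case True
  then have "s \<sqsubseteq> \<bottom>"
    using assms by (simp add: le_iff_atoms_below)
  with s show ?thesis
    by (simp add: le_antisym)
next
  case False
  then obtain p where p: "p \<in> atoms_below s"
    by blast
  have "atoms B \<subseteq> atoms_below s"
  proof
    fix q assume q: "q \<in> atoms B"
    let ?\<sigma> = "transpose p q"
    have "p \<in> atoms B"
      using p atoms_below_subset by blast
    with q have bij: "bij_betw ?\<sigma> (atoms B) (atoms B)"
      by (simp add: bij_betw_transpose_iff)
    then have "?\<sigma> ` atoms_below s \<subseteq> atoms B"
      using atoms_below_subset by (fastforce simp: bij_betw_def)
    moreover have "\<Squnion>(?\<sigma> ` atoms_below s) = s"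
      by (rule fixed[OF boolean_automorphism_of_atom_permutation[OF assms(1) bij]])
    \<comment> \<open>A set of atoms can be recovered from its join, so equal joins give equal
      sets.\<close>
    ultimately have "?\<sigma> ` atoms_below s = atoms_below s"
      by (metis atoms_below_sup)
    moreover have "q \<in> ?\<sigma> ` atoms_below s"
      using p by (metis imageI transpose_apply_first)
    ultimately show "q \<in> atoms_below s"
      by simp
  qed
  then have "\<top> \<sqsubseteq> s"
    using assms atoms_below_subset by (auto simp: le_iff_atoms_below)
  with s show ?thesis
    by (simp add: le_antisym)
qed

end


section \<open>Automorphisms and Boolean values\<close>

text \<open>The two values are defined by mutual recursion in which the arguments change places.
  Both claims are therefore proved at once, by induction on the multiset of the two arguments, the
  order that also justifies the recursion.\<close>

lemma
  assumes "complete_boolean_algebra B"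
  shows bmem_closed: "u \<in> VB B \<Longrightarrow> v \<in> VB B \<Longrightarrow> bmem B u v \<in> carrier B"
    and beq_closed: "u \<in> VB B \<Longrightarrow> v \<in> VB B \<Longrightarrow> beq B u v \<in> carrier B"
proof -
  interpret complete_boolean_algebra B by fact
  have "(u \<in> VB B \<longrightarrow> v \<in> VB B \<longrightarrow> bmem B u v \<in> carrier B) \<and>
      (u \<in> VB B \<longrightarrow> v \<in> VB B \<longrightarrow> beq B u v \<in> carrier B)" for u v
  proof (induction "{#u, v#}" arbitrary: u v rule: wf_induct_rule[OF wf_mult[OF wf_elts_trancl]])
    case (1 u v)
    have beq: "beq B x u \<in> carrier B" if "x \<in> vdom v" "u \<in> VB B" "v \<in> VB B" for x
      using 1[of x u] that by (simp add: mult_replace vdom_elts_trancl VB_vdom)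
    have bmem: "bmem B x v \<in> carrier B" if "x \<in> vdom u" "u \<in> VB B" "v \<in> VB B" for x
      using 1[of x v] that mult_replace(2)[of x u elts_trancl v]
      by (simp add: vdom_elts_trancl VB_vdom add_mset_commute)
    have bmem': "bmem B y u \<in> carrier B" if "y \<in> vdom v" "u \<in> VB B" "v \<in> VB B" for y
      using 1[of y u] that by (simp add: mult_replace vdom_elts_trancl VB_vdom)
    show ?case
      by (auto simp: bmem.simps[of B u v] beq.simps[of B u v]
          intro!: sup_closed inf_closed meet_closed bimp_closed VB_vapp beq bmem bmem')
  qed
  then show "u \<in> VB B \<Longrightarrow> v \<in> VB B \<Longrightarrow> bmem B u v \<in> carrier B"
    and "u \<in> VB B \<Longrightarrow> v \<in> VB B \<Longrightarrow> beq B u v \<in> carrier B"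
    by blast+
qed

lemma bval_closed:
  assumes "complete_boolean_algebra B"
  shows "range e \<subseteq> VB B \<Longrightarrow> bval B p e \<in> carrier B"
proof -
  interpret complete_boolean_algebra B by fact
  show "range e \<subseteq> VB B \<Longrightarrow> bval B p e \<in> carrier B"
  proof (induction p arbitrary: e)
    case (All i p)
    then have "bval B p (e(i := u)) \<in> carrier B" if "u \<in> VB B" for u
      using that by (intro All.IH) auto
    then show ?case
      by (auto intro!: inf_closed)
  next
    case (Ex i p)
    then have "bval B p (e(i := u)) \<in> carrier B" if "u \<in> VB B" for u
      using that by (intro Ex.IH) auto
    then show ?case
      by (auto intro!: sup_closed)
  qed (auto intro!: bmem_closed[OF assms] beq_closed[OF assms] simp: image_subset_iff)
qed

section \<open>Equivariance of Boolean values under a fixed automorphism\<close>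

context
  fixes B :: "'v::zfc gorder" and f :: "'v \<Rightarrow> 'v"
  assumes automorphism: "boolean_automorphism B f"
begin

interpretation boolean_automorphism B f
  by (rule automorphism)

text \<open>This lets the meets and joins that interpret quantifiers be reindexed along
  \<open>push f\<close>. Surjectivity is witnessed by \<open>push f_inv\<close>.\<close>

lemma push_image_VB: "push f ` VB B = VB B"
proof
  show "push f ` VB B \<subseteq> VB B"
    using push_in_VB[where f = f and g = f_inv, OF f_inv_left f_closed] by blast
  show "VB B \<subseteq> push f ` VB B"
  proof
    fix u assume u: "u \<in> VB B"
    then have "push f (push f_inv u) = u" "push f_inv u \<in> VB B"
      using push_push[OF u, where f = f_inv and g = f, OF f_inv_right]
        push_in_VB[where f = f_inv and g = f, OF f_inv_right f_inv_closed]
      by auto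
    then show "u \<in> push f ` VB B"
      by (metis imageI)
  qed
qed

lemma vapp_push_VB: "u \<in> VB B \<Longrightarrow> x \<in> vdom u \<Longrightarrow> vapp (push f u) (push f x) = f (vapp u x)"
  using inj_on_subset[OF inj_on_push[where f = f and g = f_inv, OF f_inv_left]] VB_vdom
  by (intro vapp_push) blast+

text \<open>The domains of \<open>push f u\<close> and \<open>push f v\<close> are images under
  \<open>push f\<close>, so the defining joins and meets can be reindexed over the original domains.
  The induction hypothesis then rewrites each term as an \<open>f\<close>-image, and
  \<open>f\<close> is pulled out of the lattice operations.\<close>

lemma bmem_beq_push:
  "u \<in> VB B \<Longrightarrow> v \<in> VB B \<Longrightarrow>
    bmem B (push f u) (push f v) = f (bmem B u v) \<and> beq B (push f u) (push f v) = f (beq B u v)"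
proof (induction "{#u, v#}" arbitrary: u v rule: wf_induct_rule[OF wf_mult[OF wf_elts_trancl]])
  case (1 u v)
  note bmem_closed = bmem_closed[OF complete_boolean_algebra_axioms]
    and beq_closed = beq_closed[OF complete_boolean_algebra_axioms]
  have closed:
    "vapp u x \<in> carrier B" "bmem B x v \<in> carrier B" if "x \<in> vdom u" for x
    using VB_vapp VB_vdom bmem_closed 1(2,3) that by blast+
  have closed':
    "vapp v x \<in> carrier B" "bmem B x u \<in> carrier B" "beq B x u \<in> carrier B" if "x \<in> vdom v" for x
    using VB_vapp VB_vdom bmem_closed beq_closed 1(2,3) that by blast+
  have beq: "beq B (push f x) (push f u) = f (beq B x u)" if "x \<in> vdom v" for x
    using 1(1)[of x u] 1(2,3) that by (simp add: mult_replace vdom_elts_trancl VB_vdom)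
  have bmem: "bmem B (push f x) (push f v) = f (bmem B x v)" if "x \<in> vdom u" for x
    using 1(1)[of x v] 1(2,3) that mult_replace(2)[of x u elts_trancl v]
    by (simp add: vdom_elts_trancl VB_vdom add_mset_commute)
  have bmem': "bmem B (push f y) (push f u) = f (bmem B y u)" if "y \<in> vdom v" for y
    using 1(1)[of y u] 1(2,3) that by (simp add: mult_replace vdom_elts_trancl VB_vdom)
  have "bmem B (push f u) (push f v) = \<Squnion>\<^bsub>B\<^esub> (f ` (\<lambda>x. vapp v x \<sqinter>\<^bsub>B\<^esub> beq B x u) ` vdom v)"
    unfolding bmem.simps[of B "push f u"] vdom_push image_image
    by (intro arg_cong[where f = "Lattice.sup B"] image_cong)
      (auto simp: vapp_push_VB 1(2,3) beq f_meet closed')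
  also have "\<dots> = f (bmem B u v)"
    unfolding bmem.simps[of B u v]
    using closed' by (intro f_sup[symmetric]) auto
  finally have *: "bmem B (push f u) (push f v) = f (bmem B u v)" .
  let ?U = "(\<lambda>x. bimp B (vapp u x) (bmem B x v)) ` vdom u"
  let ?V = "(\<lambda>y. bimp B (vapp v y) (bmem B y u)) ` vdom v"
  have UV: "?U \<subseteq> carrier B" "?V \<subseteq> carrier B"
    using closed closed' by auto
  have "beq B (push f u) (push f v) = \<Sqinter>\<^bsub>B\<^esub> (f ` ?U) \<sqinter>\<^bsub>B\<^esub> \<Sqinter>\<^bsub>B\<^esub> (f ` ?V)"
    unfolding beq.simps[of B "push f u"] vdom_push image_image
    by (intro arg_cong2[where f = "meet B"] arg_cong[where f = "Lattice.inf B"] image_cong)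
      (auto simp: vapp_push_VB 1(2,3) bmem bmem' f_bimp closed closed')
  also have "\<dots> = f (beq B u v)"
    unfolding beq.simps[of B u v] using UV by (simp add: f_meet f_inf)
  finally show ?case
    using * by simp
qed

text \<open>In the quantifier cases the index set \<open>VB B\<close> is replaced by its image under
  \<open>push f\<close>. Updating the transported assignment with \<open>push f u\<close> is the
  same as transporting the updated assignment, so the induction hypothesis applies termwise.\<close>

lemma bval_push: "range e \<subseteq> VB B \<Longrightarrow> bval B p (push f \<circ> e) = f (bval B p e)"
proof (induction p arbitrary: e)
  case (All i p)
  have e: "range (e(i := u)) \<subseteq> VB B" if "u \<in> VB B" for u
    using All.prems that by auto
  have "bval B (All i p) (push f \<circ> e) =
      \<Sqinter>\<^bsub>B\<^esub> ((\<lambda>u. bval B p ((push f \<circ> e)(i := u))) ` push f ` VB B)"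
    by (simp add: push_image_VB)
  also have "\<dots> = \<Sqinter>\<^bsub>B\<^esub> (f ` (\<lambda>u. bval B p (e(i := u))) ` VB B)"
    unfolding image_image fun_upd_comp[symmetric]
    by (rule arg_cong[where f = "Lattice.inf B"], rule image_cong[OF HOL.refl], rule All.IH[OF e])
  also have "\<dots> = f (bval B (All i p) e)"
    using bval_closed[OF complete_boolean_algebra_axioms e] by (simp add: f_inf image_subset_iff)
  finally show ?case .
next
  case (Ex i p)
  have e: "range (e(i := u)) \<subseteq> VB B" if "u \<in> VB B" for u
    using Ex.prems that by auto
  have "bval B (Ex i p) (push f \<circ> e) =
      \<Squnion>\<^bsub>B\<^esub> ((\<lambda>u. bval B p ((push f \<circ> e)(i := u))) ` push f ` VB B)"
    by (simp add: push_image_VB)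
  also have "\<dots> = \<Squnion>\<^bsub>B\<^esub> (f ` (\<lambda>u. bval B p (e(i := u))) ` VB B)"
    unfolding image_image fun_upd_comp[symmetric]
    by (rule arg_cong[where f = "Lattice.sup B"], rule image_cong[OF HOL.refl], rule Ex.IH[OF e])
  also have "\<dots> = f (bval B (Ex i p) e)"
    using bval_closed[OF complete_boolean_algebra_axioms e] by (simp add: f_sup image_subset_iff)
  finally show ?case .
next
  case (Mem i j)
  then show ?case
    using bmem_beq_push[of "e i" "e j"] by auto
next
  case (Eq i j)
  then show ?case
    using bmem_beq_push[of "e i" "e j"] by auto
qed (simp_all add: f_compl f_meet f_join f_bimp bval_closed[OF complete_boolean_algebra_axioms])

text \<open>The assignment in \<open>sval\<close> is constantly the empty name and is unchanged by
  \<open>push f\<close>, so \<open>bval_push\<close> compares a value with itself.\<close>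

lemma sval_fixed: "f (sval B p) = sval B p"
proof -
  have "push f \<circ> (\<lambda>_. set_of {}) = (\<lambda>_::nat. set_of {})"
    by (simp add: comp_def push_empty)
  moreover have "range (\<lambda>_::nat. set_of {}) \<subseteq> VB B"
    using empty_in_VB by auto
  ultimately show ?thesis
    unfolding sval_def by (metis bval_push)
qed

end

section \<open>Two-valued sentences and the modal principles\<close>

lemma sval_two_valued:
  assumes "complete_boolean_algebra B" "atomic B"
  shows "sval B p = \<bottom>\<^bsub>B\<^esub> \<or> sval B p = \<top>\<^bsub>B\<^esub>"
proof -
  interpret complete_boolean_algebra B by fact
  have "range (\<lambda>_::nat. set_of {}) \<subseteq> VB B"
    using empty_in_VB by auto
  then have "sval B p \<in> carrier B"
    unfolding sval_def by (rule bval_closed[OF assms(1)])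
  then show ?thesis
    using fixed_by_automorphisms[OF assms(2)] sval_fixed by blast
qed

text \<open>Sentences have value 0 or 1, and a nonzero state lies below 1 but not below 0; so atomic
  propositions cannot distinguish nonzero states. The connectives and modal operators preserve
  this.\<close>

lemma sat_nonbottom_iff:
  assumes "complete_boolean_algebra B" "atomic B"
    and "a \<in> carrier B" "a \<noteq> \<bottom>\<^bsub>B\<^esub>" "b \<in> carrier B" "b \<noteq> \<bottom>\<^bsub>B\<^esub>"
  shows "sat B a \<phi> \<longleftrightarrow> sat B b \<phi>"
proof -
  interpret complete_boolean_algebra B by fact
  show ?thesis
    using assms(3-)
  proof (induction \<phi> arbitrary: a b)
    case (Atom p)
    then show ?case
      using sval_two_valued[OF assms(1,2), of p] le_antisym[OF _ bottom_lower]
      by (auto simp: top_higher)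
  next
    case (Box \<phi>)
    \<comment> \<open>A nonzero state sees itself, and every state it sees is nonzero and agrees
      with it on \<phi>. The modal operator therefore collapses at nonzero states; the diamond
      behaves likewise.\<close>
    have *: "sat B c (\<^bold>\<box> \<phi>) \<longleftrightarrow> sat B c \<phi>" if "c \<in> carrier B" "c \<noteq> \<bottom>\<^bsub>B\<^esub>" for c
      unfolding sat.simps
      using Box.IH[OF that] compat_refl[OF that] compat_nonbottom(2)[of c] that by blast
    show ?case
      unfolding *[OF Box.prems(1,2)] *[OF Box.prems(3,4)] by (rule Box.IH[OF Box.prems])
  next
    case (Dia \<phi>)
    have *: "sat B c (\<^bold>\<diamond> \<phi>) \<longleftrightarrow> sat B c \<phi>" if "c \<in> carrier B" "c \<noteq> \<bottom>\<^bsub>B\<^esub>" for c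
      unfolding sat.simps
      using Dia.IH[OF that] compat_refl[OF that] compat_nonbottom(2)[of c] that by blast
    show ?case
      unfolding *[OF Dia.prems(1,2)] *[OF Dia.prems(3,4)] by (rule Dia.IH[OF Dia.prems])
  next
    case (MNot \<phi>)
    show ?case
      unfolding sat.simps MNot.IH[OF MNot.prems] by (rule HOL.refl)
  next
    case (MAnd \<phi> \<psi>)
    show ?case
      unfolding sat.simps MAnd.IH(1)[OF MAnd.prems] MAnd.IH(2)[OF MAnd.prems] by (rule HOL.refl)
  next
    case (MOr \<phi> \<psi>)
    show ?case
      unfolding sat.simps MOr.IH(1)[OF MOr.prems] MOr.IH(2)[OF MOr.prems] by (rule HOL.refl)
  next
    case (MImp \<phi> \<psi>)
    show ?case
      unfolding sat.simps MImp.IH(1)[OF MImp.prems] MImp.IH(2)[OF MImp.prems] by (rule HOL.refl)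
  qed
qed

theorem theorem4p6:
  fixes B :: "'v::zfc gorder"
  assumes "carrier B \<in> range elts"
    and "complete_boolean B"
  shows "(\<forall>\<phi> \<psi>.
      (\<^bold>\<box> (\<phi> \<^bold>\<rightarrow> \<psi>) \<^bold>\<rightarrow> (\<^bold>\<box> \<phi> \<^bold>\<rightarrow> \<^bold>\<box> \<psi>)) \<in> TH B \<and>
      (\<^bold>\<not> \<^bold>\<diamond> \<phi> \<^bold>\<leftrightarrow> \<^bold>\<box> \<^bold>\<not> \<phi>) \<in> TH B \<and>
      (\<phi> \<^bold>\<rightarrow> \<^bold>\<box> \<^bold>\<diamond> \<phi>) \<in> TH B \<and>
      (\<^bold>\<diamond> \<^bold>\<box> \<phi> \<^bold>\<rightarrow> \<^bold>\<box> \<^bold>\<diamond> \<phi>) \<in> TH B \<and>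
      (\<^bold>\<diamond> \<^bold>\<box> \<phi> \<^bold>\<rightarrow> \<phi>) \<in> TH B \<and>
      (\<^bold>\<box> (\<^bold>\<box> (\<phi> \<^bold>\<rightarrow> \<^bold>\<box> \<phi>) \<^bold>\<rightarrow> \<phi>) \<^bold>\<rightarrow> (\<^bold>\<diamond> \<^bold>\<box> \<phi> \<^bold>\<rightarrow> \<phi>)) \<in> TH B) \<and>
    (atomic B \<longrightarrow> (\<forall>\<phi>.
      (\<^bold>\<box> \<phi> \<^bold>\<rightarrow> \<^bold>\<box> \<^bold>\<box> \<phi>) \<in> TH B \<and>
      (\<^bold>\<diamond> \<phi> \<^bold>\<rightarrow> \<^bold>\<box> \<^bold>\<diamond> \<phi>) \<in> TH B \<and>
      (\<^bold>\<diamond> \<^bold>\<box> \<phi> \<^bold>\<rightarrow> (\<phi> \<^bold>\<rightarrow> \<^bold>\<box> \<phi>)) \<in> TH B))"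
proof -
  interpret complete_boolean_algebra B
    using assms(2) by (rule complete_boolean_algebraI)
  have "(\<^bold>\<box> \<phi> \<^bold>\<rightarrow> \<^bold>\<box> \<^bold>\<box> \<phi>) \<in> TH B \<and> (\<^bold>\<diamond> \<phi> \<^bold>\<rightarrow> \<^bold>\<box> \<^bold>\<diamond> \<phi>) \<in> TH B \<and>
      (\<^bold>\<diamond> \<^bold>\<box> \<phi> \<^bold>\<rightarrow> (\<phi> \<^bold>\<rightarrow> \<^bold>\<box> \<phi>)) \<in> TH B" if "atomic B" for \<phi>
  proof -
    note iff = sat_nonbottom_iff[OF complete_boolean_algebra_axioms that]
    \<comment> \<open>Compatible states are both nonzero, so truth passes along the accessibility
      relation in either direction.\<close>
    have eq: "sat B a \<psi> \<longleftrightarrow> sat B b \<psi>" if "a \<in> carrier B" "b \<in> carrier B" "compat B a b" for a b \<psi>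
      using iff that compat_nonbottom by blast
    show ?thesis
      \<comment> \<open>For (4), \<phi> is carried along two accessibility steps; for (5), the
        original state serves as the witness seen from each of its successors; for (W5), \<phi> is
        carried along one step.\<close>
      unfolding TH_def mem_Collect_eq sat.simps
      using eq[where \<psi> = \<phi>] by (intro conjI ballI impI) (meson compat_commute)+
  qed
  moreover have "(\<^bold>\<box> (\<phi> \<^bold>\<rightarrow> \<psi>) \<^bold>\<rightarrow> (\<^bold>\<box> \<phi> \<^bold>\<rightarrow> \<^bold>\<box> \<psi>)) \<in> TH B \<and>
      (\<^bold>\<not> \<^bold>\<diamond> \<phi> \<^bold>\<leftrightarrow> \<^bold>\<box> \<^bold>\<not> \<phi>) \<in> TH B \<and>
      (\<phi> \<^bold>\<rightarrow> \<^bold>\<box> \<^bold>\<diamond> \<phi>) \<in> TH B \<and>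
      (\<^bold>\<diamond> \<^bold>\<box> \<phi> \<^bold>\<rightarrow> \<^bold>\<box> \<^bold>\<diamond> \<phi>) \<in> TH B \<and>
      (\<^bold>\<diamond> \<^bold>\<box> \<phi> \<^bold>\<rightarrow> \<phi>) \<in> TH B \<and>
      (\<^bold>\<box> (\<^bold>\<box> (\<phi> \<^bold>\<rightarrow> \<^bold>\<box> \<phi>) \<^bold>\<rightarrow> \<phi>) \<^bold>\<rightarrow> (\<^bold>\<diamond> \<^bold>\<box> \<phi> \<^bold>\<rightarrow> \<phi>)) \<in> TH B" for \<phi> \<psi>
    \<comment> \<open>By symmetry a successor satisfying the box of \<phi> looks back at the
      original state, which gives \<phi> there. The last principle follows from this alone, and the
      fourth because every successor also sees the original state.\<close>
    unfolding TH_def mem_Collect_eq sat.simps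
    by (intro conjI ballI impI) (meson compat_commute)+
  ultimately show ?thesis
    by blast
qed

end
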